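(* For the $5\times 3$ case, $z_{wL}(5,3)\ge 10$, and hence $\mathrm{BSR}(5,3)\ge 10$.
   Context: Notation: $[m]=\{1,\dots,m\}$. An $m\times n$ biquadratic form is a real polynomial $P(\mathbf{x},\mathbf{y})=\sum_{i,k=1}^m\sum_{j,l=1}^n a_{ijkl}x_ix_ky_jy_l$ (with $a_{ijkl}=a_{kjil}=a_{klij}$). It is SOS if $P=\sum_{p=1}^r f_p^2$ with each $f_p$ a real bilinear form in $(\mathbf{x},\mathbf{y})$; the minimum such $r$ is its SOS rank $\mathrm{SOS}(P)$. $\mathrm{BSR}(m,n)$ is the maximum SOS rank among all $m\times n$ SOS biquadratic forms. $z(m,n)$ (the Zarankiewicz number) is the maximum number of edges of an $m\times n$ bipartite graph with no $C_4$. Augmented bipartite graphs $G=(S,T,E_1\cup E_2)$, $S=[m]$, $T=[n]$. A cell is a pair $(i,j)\in[m]\times[n]$ ($i$ is its row, $j$ its column). A 1-edge is a cell; $E_1$ is a set of 1-edges, viewed as a bipartite graph $G_1$ on $S,T$. A 2-edge is an unordered pair of distinct cells, written $(i,j;k,l)$; the cells $(i,j)$ and $(k,l)$ are its two halves. It is nondegenerate if $i\ne k$ and $j\ne l$, row-degenerate if $i=k$ and $j\neq l$, column-degenerate if $i\ne k$ and $j=l$. $E_2$ is a set of 2-edges. A cell is occupied if it is in $E_1$ or is a half of some 2-edge in $E_2$; otherwise it is unoccupied. The opposite cells of a nondegenerate 2-edge $(i,j;k,l)$ are $(i,l)$ and $(k,j)$. Two nondegenerate 2-edges of the form $(i,j;k,l)$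 and $(i,l;k,j)$ are called complementary. The dependency graph $\mathcal{D}$ is the directed graph whose vertices are the nondegenerate 2-edges in $E_2$, with an arc $e\to e'$ ($e\ne e'$) if both opposite cells of $e$ are occupied and one half of $e'$ is an opposite cell of $e$. An edge's row (column) set is the set of rows (columns) of its cell (1-edge) or of its halves (2-edge). Two edges are vertex-disjoint if their row sets are disjoint and their column sets are disjoint. The opposite cells of a vertex-disjoint pair $e,f$ are the cells formed by a row of one of the two edges and a column of the other. For a 1-edge $(i,j)$ and a 2-edge $(k,l;p,q)$ they are $(i,l),(i,q),(k,j),(p,j)$. Conditions: (S) No 2-edge shares a cell with any 1-edge or with any other 2-edge. (W1) $G_1$ contains no $C_4$. (W2) $\mathcal{D}$ contains no directed cycle other than 2-cycles formed by a pair of complementary 2-edges (which are allowed). (W2') There is no nondegenerate 2-edge in $E_2$ whose two opposite cells are both 1-edges. (W3) For every vertex-disjoint pair of edges of $G$ at least one of which is a 2-edge, at least one of the opposite cells of the pair is unoccupied. $z_{wL}(m,n)$ is the maximum of $|E_1|+|E_2|$ over all $G$ satisfying (S), (W1), (W2), (W2'), (W3) and $|E_1|=z(m,n)$. *)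

theory Defs
  imports Complex_Main "Graph_Theory.Pair_Digraph"
begin

section \<open>Biquadratic forms and their SOS rank\<close>

text \<open>
  Real polynomials are identified with the functions they induce, which is harmless over an
  infinite field. A vector is a function on the naturals of which only the coordinates
  \<open>1, \<dots>, m\<close> (for \<open>x\<close>) and \<open>1, \<dots>, n\<close> (for \<open>y\<close>) are used.
\<close>

type_synonym form = "(nat \<Rightarrow> real) \<Rightarrow> (nat \<Rightarrow> real) \<Rightarrow> real"

definition biquadratic_form :: "nat \<Rightarrow> nat \<Rightarrow> form \<Rightarrow> bool" where
  "biquadratic_form m n P \<longleftrightarrow>
     (\<exists>a :: nat \<Rightarrow> nat \<Rightarrow> nat \<Rightarrow> nat \<Rightarrow> real.
        (\<forall>i\<in>{1..m}. \<forall>j\<in>{1..n}. \<forall>k\<in>{1..m}. \<forall>l\<in>{1..n}.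
            a i j k l = a k j i l \<and> a k j i l = a k l i j) \<and>
        P = (\<lambda>x y. \<Sum>i\<in>{1..m}. \<Sum>k\<in>{1..m}. \<Sum>j\<in>{1..n}. \<Sum>l\<in>{1..n}.
               a i j k l * x i * x k * y j * y l))"

definition bilinear_form :: "nat \<Rightarrow> nat \<Rightarrow> form \<Rightarrow> bool" where
  "bilinear_form m n f \<longleftrightarrow>
     (\<exists>b :: nat \<Rightarrow> nat \<Rightarrow> real. f = (\<lambda>x y. \<Sum>i\<in>{1..m}. \<Sum>j\<in>{1..n}. b i j * x i * y j))"

definition sum_of_squares :: "nat \<Rightarrow> nat \<Rightarrow> nat \<Rightarrow> form \<Rightarrow> bool" where
  "sum_of_squares m n r P \<longleftrightarrow>
     (\<exists>f :: nat \<Rightarrow> form. (\<forall>p\<in>{1..r}. bilinear_form m n (f p)) \<and>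
        P = (\<lambda>x y. \<Sum>p\<in>{1..r}. (f p x y)\<^sup>2))"

definition SOS :: "nat \<Rightarrow> nat \<Rightarrow> form \<Rightarrow> bool" where
  "SOS m n P \<longleftrightarrow> (\<exists>r. sum_of_squares m n r P)"

definition SOS_rank :: "nat \<Rightarrow> nat \<Rightarrow> form \<Rightarrow> nat" where
  "SOS_rank m n P = (LEAST r. sum_of_squares m n r P)"

definition BSR :: "nat \<Rightarrow> nat \<Rightarrow> nat" where
  "BSR m n = Max {SOS_rank m n P | P. biquadratic_form m n P \<and> SOS m n P}"


section \<open>Zarankiewicz numbers\<close>

type_synonym cell = "nat \<times> nat"

definition cells :: "nat \<Rightarrow> nat \<Rightarrow> cell set" where
  "cells m n = {1..m} \<times> {1..n}"

definition C4_free :: "cell set \<Rightarrow> bool" where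
  "C4_free E \<longleftrightarrow>
     \<not> (\<exists>i j k l. i \<noteq> k \<and> j \<noteq> l \<and> {(i, j), (i, l), (k, j), (k, l)} \<subseteq> E)"

definition zarankiewicz :: "nat \<Rightarrow> nat \<Rightarrow> nat" where
  "zarankiewicz m n = Max {card E | E. E \<subseteq> cells m n \<and> C4_free E}"


section \<open>Augmented bipartite graphs\<close>

text \<open>
  An edge is represented by its set of cells, so the 2-edge \<open>(i,j;k,l)\<close> is
  \<open>{(i,j), (k,l)}\<close>. In \<open>E1\<close> a 1-edge is given by its cell \<open>c\<close>; where 1-edges and 2-edges
  are treated alike it becomes \<open>{c}\<close>.
\<close>

type_synonym edge = "cell set"

definition two_edges :: "nat \<Rightarrow> nat \<Rightarrow> edge set" where
  "two_edges m n = {{c, d} | c d. c \<in> cells m n \<and> d \<in> cells m n \<and> c \<noteq> d}"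

definition augmented_graph :: "nat \<Rightarrow> nat \<Rightarrow> cell set \<Rightarrow> edge set \<Rightarrow> bool" where
  "augmented_graph m n E1 E2 \<longleftrightarrow> E1 \<subseteq> cells m n \<and> E2 \<subseteq> two_edges m n"

definition nondegenerate :: "edge \<Rightarrow> bool" where
  "nondegenerate e \<longleftrightarrow> (\<exists>i j k l. e = {(i, j), (k, l)} \<and> i \<noteq> k \<and> j \<noteq> l)"

definition occupied :: "cell set \<Rightarrow> edge set \<Rightarrow> cell set" where
  "occupied E1 E2 = E1 \<union> \<Union>E2"

definition opposite_cells :: "edge \<Rightarrow> cell set" where
  "opposite_cells e = {(i, l) | i j k l. (i, j) \<in> e \<and> (k, l) \<in> e \<and> (i, j) \<noteq> (k, l)}"

lemma opposite_cells_nondegenerate: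
  "i \<noteq> k \<Longrightarrow> j \<noteq> l \<Longrightarrow> opposite_cells {(i, j), (k, l)} = {(i, l), (k, j)}"
  unfolding opposite_cells_def by auto

definition complementary :: "edge \<Rightarrow> edge \<Rightarrow> bool" where
  "complementary e f \<longleftrightarrow>
     (\<exists>i j k l. i \<noteq> k \<and> j \<noteq> l \<and> e = {(i, j), (k, l)} \<and> f = {(i, l), (k, j)})"

definition dependency_graph :: "cell set \<Rightarrow> edge set \<Rightarrow> edge pair_pre_digraph" where
  "dependency_graph E1 E2 =
     \<lparr> pverts = {e \<in> E2. nondegenerate e},
       parcs = {(e, f). e \<in> E2 \<and> nondegenerate e \<and> f \<in> E2 \<and> nondegenerate f \<and> e \<noteq> f \<and>
                  opposite_cells e \<subseteq> occupied E1 E2 \<and> f \<inter> opposite_cells e \<noteq> {}} \<rparr>"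

definition vertex_disjoint :: "edge \<Rightarrow> edge \<Rightarrow> bool" where
  "vertex_disjoint e f \<longleftrightarrow> fst ` e \<inter> fst ` f = {} \<and> snd ` e \<inter> snd ` f = {}"

definition pair_opposite_cells :: "edge \<Rightarrow> edge \<Rightarrow> cell set" where
  "pair_opposite_cells e f = fst ` e \<times> snd ` f \<union> fst ` f \<times> snd ` e"

lemma pair_opposite_cells_1_2:
  "pair_opposite_cells {(i, j)} {(k, l), (p, q)} = {(i, l), (i, q), (k, j), (p, j)}"
  unfolding pair_opposite_cells_def by auto

definition cond_S :: "cell set \<Rightarrow> edge set \<Rightarrow> bool" where
  "cond_S E1 E2 \<longleftrightarrow> (\<forall>e\<in>E2. (\<forall>c\<in>E1. c \<notin> e) \<and> (\<forall>f\<in>E2. f \<noteq> e \<longrightarrow> e \<inter> f = {}))"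

definition cond_W1 :: "cell set \<Rightarrow> bool" where
  "cond_W1 E1 \<longleftrightarrow> C4_free E1"

text \<open>
  A library \<open>cycle\<close> is a nonempty closed walk, given by its list of arcs, that does not repeat
  vertices. The dependency graph has no loops, so its shortest cycles are 2-cycles.
\<close>

definition cond_W2 :: "cell set \<Rightarrow> edge set \<Rightarrow> bool" where
  "cond_W2 E1 E2 \<longleftrightarrow>
     (\<forall>p. pre_digraph.cycle (with_proj (dependency_graph E1 E2)) p \<longrightarrow>
        (\<exists>e f. complementary e f \<and> p = [(e, f), (f, e)]))"

definition cond_W2' :: "cell set \<Rightarrow> edge set \<Rightarrow> bool" where
  "cond_W2' E1 E2 \<longleftrightarrow> \<not> (\<exists>e\<in>E2. nondegenerate e \<and> opposite_cells e \<subseteq> E1)"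

definition cond_W3 :: "cell set \<Rightarrow> edge set \<Rightarrow> bool" where
  "cond_W3 E1 E2 \<longleftrightarrow>
     (\<forall>e\<in>E2. \<forall>f \<in> E2 \<union> (\<lambda>c. {c}) ` E1. vertex_disjoint e f \<longrightarrow>
        (\<exists>c \<in> pair_opposite_cells e f. c \<notin> occupied E1 E2))"

definition z_wL :: "nat \<Rightarrow> nat \<Rightarrow> nat" where
  "z_wL m n = Max {card E1 + card E2 | E1 E2.
     augmented_graph m n E1 E2 \<and> cond_S E1 E2 \<and> cond_W1 E1 \<and> cond_W2 E1 E2 \<and>
     cond_W2' E1 E2 \<and> cond_W3 E1 E2 \<and> card E1 = zarankiewicz m n}"

end

theory Submission
  imports Defs
begin

text \<open>
  A \<open>C\<^sub>4\<close>-free graph with 8 edges is extended by two row-degenerate 2-edges; as no 2-edge is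
  nondegenerate, the dependency graph is empty. If the biquadratic form of this graph, the sum
  over its 10 edges of the squares of \<open>x\<^sub>i y\<^sub>j\<close> or \<open>x\<^sub>i y\<^sub>j + x\<^sub>i y\<^sub>l\<close>, is written as \<open>r\<close> squares
  of bilinear forms, then the coefficients at a cell form a vector in \<open>\<real>\<^sup>r\<close>. Comparing
  coefficients shows that unoccupied cells have the zero vector, the halves of a 2-edge have
  equal vectors, and the 10 vectors belonging to the edges are orthonormal, so \<open>r \<ge> 10\<close>.
  That the maximum defining \<open>BSR\<close> is taken over a finite set follows from
  \<open>SOS_rank m n P \<le> m * n\<close>, proved by completing squares.
\<close>

section \<open>Sums of squares in coordinates\<close>

lemma bilinear_form_iff:
  "bilinear_form m n f \<longleftrightarrow>
     (\<exists>b :: cell \<Rightarrow> real. f = (\<lambda>x y. \<Sum>c\<in>cells m n. b c * (x (fst c) * y (snd c))))"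
proof
  assume "bilinear_form m n f"
  then obtain b where "f = (\<lambda>x y. \<Sum>i\<in>{1..m}. \<Sum>j\<in>{1..n}. b i j * x i * y j)"
    unfolding bilinear_form_def by blast
  then have "f = (\<lambda>x y. \<Sum>c\<in>cells m n. case_prod b c * (x (fst c) * y (snd c)))"
    by (simp add: cells_def sum.cartesian_product case_prod_beta mult.assoc)
  then show "\<exists>b. f = (\<lambda>x y. \<Sum>c\<in>cells m n. b c * (x (fst c) * y (snd c)))"
    by blast
next
  assume "\<exists>b. f = (\<lambda>x y. \<Sum>c\<in>cells m n. b c * (x (fst c) * y (snd c)))"
  then obtain b where "f = (\<lambda>x y. \<Sum>c\<in>cells m n. b c * (x (fst c) * y (snd c)))" ..
  then have "f = (\<lambda>x y. \<Sum>i\<in>{1..m}. \<Sum>j\<in>{1..n}. curry b i j * x i * y j)"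
    by (simp add: cells_def sum.cartesian_product case_prod_beta mult.assoc)
  then show "bilinear_form m n f"
    unfolding bilinear_form_def by blast
qed

text \<open>The index set is arbitrary, so that squares can be indexed by cells or edges as well as
  by \<open>{1..r}\<close>.\<close>

definition square_sum :: "nat \<Rightarrow> nat \<Rightarrow> 'i set \<Rightarrow> ('i \<Rightarrow> cell \<Rightarrow> real) \<Rightarrow> form" where
  "square_sum m n I b =
     (\<lambda>x y. \<Sum>p\<in>I. (\<Sum>c\<in>cells m n. b p c * (x (fst c) * y (snd c)))\<^sup>2)"

lemma finite_cells [simp]: "finite (cells m n)"
  by (simp add: cells_def)

lemma card_cells [simp]: "card (cells m n) = m * n"
  by (simp add: cells_def)

lemma sum_of_squares_iff:
  "sum_of_squares m n r P \<longleftrightarrow> (\<exists>b. P = square_sum m n {1..r} b)"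
proof
  assume "sum_of_squares m n r P"
  then obtain f where f: "\<forall>p\<in>{1..r}. bilinear_form m n (f p)"
    and P: "P = (\<lambda>x y. \<Sum>p\<in>{1..r}. (f p x y)\<^sup>2)"
    unfolding sum_of_squares_def by blast
  obtain b where
    b: "\<forall>p\<in>{1..r}. f p = (\<lambda>x y. \<Sum>c\<in>cells m n. b p c * (x (fst c) * y (snd c)))"
    using bchoice[OF f[unfolded bilinear_form_iff]] ..
  have "P = square_sum m n {1..r} b"
    unfolding P square_sum_def by (rule ext, rule ext, rule sum.cong[OF refl]) (simp only: b)
  then show "\<exists>b. P = square_sum m n {1..r} b"
    by blast
next
  assume "\<exists>b. P = square_sum m n {1..r} b"
  then obtain b where "P = square_sum m n {1..r} b" ..
  then have
    "P = (\<lambda>x y. \<Sum>p\<in>{1..r}. (\<Sum>c\<in>cells m n. b p c * (x (fst c) * y (snd c)))\<^sup>2)"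
    by (simp only: square_sum_def)
  moreover have "bilinear_form m n (\<lambda>x y. \<Sum>c\<in>cells m n. b p c * (x (fst c) * y (snd c)))" for p
    unfolding bilinear_form_iff by (rule exI[of _ "b p"]) (rule refl)
  ultimately show "sum_of_squares m n r P"
    unfolding sum_of_squares_def
    by (intro exI[of _ "\<lambda>p x y. \<Sum>c\<in>cells m n. b p c * (x (fst c) * y (snd c))"] conjI ballI)
qed

lemma sum_of_squares_square_sum:
  assumes "finite I"
  shows "sum_of_squares m n (card I) (square_sum m n I b)"
proof -
  obtain h where h: "bij_betw h {1..card I} I"
    using ex_bij_betw_nat_finite_1[OF assms] by blast
  have "square_sum m n I b = square_sum m n {1..card I} (b \<circ> h)"
    unfolding square_sum_def
    by (intro ext) (simp add: sum.reindex_bij_betw[OF h, symmetric])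
  then show ?thesis
    unfolding sum_of_squares_iff by blast
qed

text \<open>The products \<open>b p (i, j) * b p (k, l)\<close> lack the required symmetry.
  Averaging them with their versions under the swap of \<open>j\<close> and \<open>l\<close>
  restores it without changing the form.\<close>

lemma biquadratic_form_square_sum: "biquadratic_form m n (square_sum m n I b)"
proof -
  define a where "a i j k l = (\<Sum>p\<in>I. b p (i, j) * b p (k, l) + b p (i, l) * b p (k, j)) / 2"
    for i j k l
  have sym: "a i j k l = a k j i l" "a k j i l = a k l i j" for i j k l
    by (simp_all add: a_def algebra_simps)
  have "square_sum m n I b x y =
      (\<Sum>i\<in>{1..m}. \<Sum>k\<in>{1..m}. \<Sum>j\<in>{1..n}. \<Sum>l\<in>{1..n}. a i j k l * x i * x k * y j * y l)" for x y
  proof -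
    let ?S = "\<lambda>p. \<Sum>i\<in>{1..m}. \<Sum>k\<in>{1..m}. \<Sum>j\<in>{1..n}. \<Sum>l\<in>{1..n}.
      b p (i, j) * b p (k, l) * (x i * x k * y j * y l)"
    let ?T = "\<lambda>p. \<Sum>i\<in>{1..m}. \<Sum>k\<in>{1..m}. \<Sum>j\<in>{1..n}. \<Sum>l\<in>{1..n}.
      b p (i, l) * b p (k, j) * (x i * x k * y j * y l)"
    have S: "(\<Sum>c\<in>cells m n. b p c * (x (fst c) * y (snd c)))\<^sup>2 = ?S p" for p
    proof -
      have "(\<Sum>c\<in>cells m n. b p c * (x (fst c) * y (snd c)))\<^sup>2 =
          (\<Sum>i\<in>{1..m}. \<Sum>j\<in>{1..n}. b p (i, j) * (x i * y j))\<^sup>2"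
        by (simp add: cells_def sum.cartesian_product case_prod_beta)
      also have "\<dots> = ?S p"
        by (simp add: power2_eq_square sum_product mult_ac)
      finally show ?thesis .
    qed
    have T: "?T p = ?S p" for p
      by (rule sum.cong[OF refl], rule sum.cong[OF refl], subst sum.swap) (simp add: mult_ac)
    have coeff: "a i j k l * x i * x k * y j * y l = (\<Sum>p\<in>I.
        (b p (i, j) * b p (k, l) * (x i * x k * y j * y l)
         + b p (i, l) * b p (k, j) * (x i * x k * y j * y l)) / 2)" for i j k l
      by (simp add: a_def sum_distrib_right sum_divide_distrib ring_distribs mult.assoc)
    have "(\<Sum>i\<in>{1..m}. \<Sum>k\<in>{1..m}. \<Sum>j\<in>{1..n}. \<Sum>l\<in>{1..n}. a i j k l * x i * x k * y j * y l)
        = (\<Sum>i\<in>{1..m}. \<Sum>k\<in>{1..m}. \<Sum>j\<in>{1..n}. \<Sum>l\<in>{1..n}. \<Sum>p\<in>I.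
            (b p (i, j) * b p (k, l) * (x i * x k * y j * y l)
             + b p (i, l) * b p (k, j) * (x i * x k * y j * y l)) / 2)"
      by (simp only: coeff)
    also have "\<dots> = (\<Sum>p\<in>I. \<Sum>i\<in>{1..m}. \<Sum>k\<in>{1..m}. \<Sum>j\<in>{1..n}. \<Sum>l\<in>{1..n}.
            (b p (i, j) * b p (k, l) * (x i * x k * y j * y l)
             + b p (i, l) * b p (k, j) * (x i * x k * y j * y l)) / 2)"
      by (simp only: sum.swap[of _ I])
    also have "\<dots> = (\<Sum>p\<in>I. (?S p + ?T p) / 2)"
      by (simp only: sum.distrib sum_divide_distrib add_divide_distrib)
    also have "\<dots> = square_sum m n I b x y"
      by (simp only: square_sum_def S T) simp
    finally show ?thesis ..
  qed
  with sym show ?thesis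
    unfolding biquadratic_form_def by blast
qed

section \<open>Boundedness of the SOS rank\<close>

text \<open>
  Completing the square with respect to one variable leaves a sum of squares with the same
  index set in the remaining variables, since projecting the coefficient vectors onto the
  orthogonal complement of the eliminated one acts on each square separately.
\<close>

lemma sum_squares_reduce:
  fixes b :: "'i \<Rightarrow> 'k \<Rightarrow> real"
  assumes "finite K" "finite I"
  shows "\<exists>c :: 'k \<Rightarrow> 'k \<Rightarrow> real. \<forall>t.
    (\<Sum>i\<in>I. (\<Sum>k\<in>K. b i k * t k)\<^sup>2) = (\<Sum>q\<in>K. (\<Sum>k\<in>K. c q k * t k)\<^sup>2)"
  using assms(1)
proof (induction K arbitrary: b rule: finite_induct)
  case empty
  then show ?case by simp
next
  case (insert a K)
  define s where "s = (\<Sum>i\<in>I. (b i a)\<^sup>2)"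
  \<comment> \<open>If \<open>s = 0\<close> then \<open>\<beta> = 0\<close>, and the construction remains valid.\<close>
  define \<beta> where "\<beta> k = (\<Sum>i\<in>I. b i a * b i k) / s" for k
  define b' where "b' i k = b i k - b i a * \<beta> k" for i k
  obtain c where c: "\<And>t. (\<Sum>i\<in>I. (\<Sum>k\<in>K. b' i k * t k)\<^sup>2) = (\<Sum>q\<in>K. (\<Sum>k\<in>K. c q k * t k)\<^sup>2)"
    using insert.IH[of b'] by blast
  \<comment> \<open>Row \<open>a\<close> carries the completed square \<open>s * u\<^sup>2\<close>;
    the other rows no longer involve \<open>t a\<close>.\<close>
  define c' where "c' q k = (if q = a then sqrt s * (if k = a then 1 else \<beta> k)
    else if k = a then 0 else c q k)" for q k
  have "(\<Sum>i\<in>I. (\<Sum>k\<in>insert a K. b i k * t k)\<^sup>2) =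
      (\<Sum>q\<in>insert a K. (\<Sum>k\<in>insert a K. c' q k * t k)\<^sup>2)" for t
  proof -
    define u where "u = t a + (\<Sum>k\<in>K. \<beta> k * t k)"
    define w where "w i = (\<Sum>k\<in>K. b' i k * t k)" for i
    have split: "(\<Sum>k\<in>insert a K. b i k * t k) = b i a * u + w i" for i
      using insert.hyps
      by (simp add: u_def w_def b'_def algebra_simps sum_subtractf sum_distrib_left)
    have "(\<Sum>i\<in>I. b i a * b' i k) = 0" for k
    proof (cases "s = 0")
      case True
      then have "\<forall>i\<in>I. b i a = 0"
        using assms(2) by (simp add: s_def sum_nonneg_eq_0_iff)
      then show ?thesis by simp
    next
      case False
      have "(\<Sum>i\<in>I. b i a * b' i k) = (\<Sum>i\<in>I. b i a * b i k) - s * \<beta> k"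
        by (simp add: b'_def s_def algebra_simps power2_eq_square sum_subtractf sum_distrib_left)
      with False show ?thesis by (simp add: \<beta>_def)
    qed
    then have orth: "(\<Sum>i\<in>I. b i a * w i) = 0"
      unfolding w_def sum_distrib_left
      by (subst sum.swap) (simp add: mult.assoc[symmetric] sum_distrib_right[symmetric])
    have "(\<Sum>i\<in>I. (b i a * u + w i)\<^sup>2) = s * u\<^sup>2 + 2 * u * (\<Sum>i\<in>I. b i a * w i) + (\<Sum>i\<in>I. (w i)\<^sup>2)"
      by (simp add: s_def power2_sum power_mult_distrib sum.distrib sum_distrib_left
          sum_distrib_right mult_ac)
    also have "\<dots> = s * u\<^sup>2 + (\<Sum>i\<in>I. (w i)\<^sup>2)"
      using orth by simp
    also have "\<dots> = (\<Sum>q\<in>insert a K. (\<Sum>k\<in>insert a K. c' q k * t k)\<^sup>2)"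
    proof -
      have "(\<Sum>k\<in>insert a K. c' a k * t k) = sqrt s * u"
      proof -
        have "(\<Sum>k\<in>K. c' a k * t k) = (\<Sum>k\<in>K. sqrt s * (\<beta> k * t k))"
          using insert.hyps by (intro sum.cong) (auto simp: c'_def)
        then show ?thesis
          using insert.hyps by (simp add: u_def c'_def distrib_left sum_distrib_left)
      qed
      moreover have "(\<Sum>k\<in>insert a K. c' q k * t k) = (\<Sum>k\<in>K. c q k * t k)" if "q \<in> K" for q
      proof -
        have "(\<Sum>k\<in>K. c' q k * t k) = (\<Sum>k\<in>K. c q k * t k)"
          using insert.hyps that by (intro sum.cong) (auto simp: c'_def)
        then show ?thesis
          using insert.hyps that by (auto simp: c'_def)
      qed
      moreover have "(\<Sum>i\<in>I. (w i)\<^sup>2) = (\<Sum>q\<in>K. (\<Sum>k\<in>K. c q k * t k)\<^sup>2)"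
        unfolding w_def by (rule c)
      moreover have "s \<ge> 0"
        by (simp add: s_def sum_nonneg)
      ultimately show ?thesis
        using sum.insert[OF insert.hyps, of "\<lambda>q. (\<Sum>k\<in>insert a K. c' q k * t k)\<^sup>2"]
        by (simp del: sum.insert add: power_mult_distrib)
    qed
    finally show ?thesis
      unfolding split .
  qed
  then show ?case by blast
qed

text \<open>The \<open>m * n\<close> products of an \<open>x\<close> and a \<open>y\<close>
  coordinate are treated as independent variables of a quadratic form.\<close>

lemma SOS_rank_le:
  assumes "SOS m n P"
  shows "SOS_rank m n P \<le> m * n"
proof -
  obtain r :: nat and b where P: "P = square_sum m n {1..r} b"
    using assms unfolding SOS_def sum_of_squares_iff by blast
  obtain c where "\<And>t. (\<Sum>p\<in>{1..r}. (\<Sum>k\<in>cells m n. b p k * t k)\<^sup>2) =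
      (\<Sum>q\<in>cells m n. (\<Sum>k\<in>cells m n. c q k * t k)\<^sup>2)"
    using sum_squares_reduce[of "cells m n" "{1..r}" b] by auto
  then have "P = square_sum m n (cells m n) c"
    unfolding P square_sum_def by simp
  then have "sum_of_squares m n (m * n) P"
    using sum_of_squares_square_sum[of "cells m n" m n c] by simp
  then show ?thesis
    unfolding SOS_rank_def by (rule Least_le)
qed

lemma SOS_rank_le_BSR:
  assumes "biquadratic_form m n P" "SOS m n P"
  shows "SOS_rank m n P \<le> BSR m n"
proof -
  have "finite {SOS_rank m n P | P. biquadratic_form m n P \<and> SOS m n P}"
    by (rule finite_subset[of _ "{..m * n}"]) (auto simp: SOS_rank_le)
  with assms show ?thesis
    unfolding BSR_def by (intro Max_ge) auto
qed

section \<open>Gram vectors of a sum of squares\<close>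

text \<open>Bessel's inequality for each standard basis vector of the space indexed by
  \<open>I\<close>, summed over \<open>I\<close>, bounds the total squared norm, which is
  \<open>card E\<close>.\<close>

lemma card_orthonormal_le:
  fixes v :: "'e \<Rightarrow> 'i \<Rightarrow> real"
  assumes "finite E" "finite I"
    and on: "\<And>c d. c \<in> E \<Longrightarrow> d \<in> E \<Longrightarrow> (\<Sum>p\<in>I. v c p * v d p) = of_bool (c = d)"
  shows "card E \<le> card I"
proof -
  have bessel: "(\<Sum>c\<in>E. (v c p)\<^sup>2) \<le> 1" if p: "p \<in> I" for p
  proof -
    \<comment> \<open>This is the projection of the \<open>p\<close>-th basis vector onto the span
      of the family; the squared norm of the remainder is nonnegative.\<close>
    let ?w = "\<lambda>q. \<Sum>c\<in>E. v c p * v c q"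
    have cross: "(\<Sum>q\<in>I. of_bool (p = q) * ?w q) = (\<Sum>c\<in>E. (v c p)\<^sup>2)"
      using p assms(2) by (simp add: power2_eq_square of_bool_def if_distrib[of "\<lambda>z. z * _"] cong: if_cong)
    have "(\<Sum>q\<in>I. (?w q)\<^sup>2) = (\<Sum>q\<in>I. \<Sum>c\<in>E. \<Sum>d\<in>E. v c p * v d p * (v c q * v d q))"
      by (simp add: power2_eq_square sum_product mult_ac)
    also have "\<dots> = (\<Sum>c\<in>E. \<Sum>d\<in>E. \<Sum>q\<in>I. v c p * v d p * (v c q * v d q))"
      by (simp only: sum.swap[of _ I])
    also have "\<dots> = (\<Sum>c\<in>E. \<Sum>d\<in>E. v c p * v d p * of_bool (c = d))"
      by (intro sum.cong refl) (simp add: on sum_distrib_left[symmetric])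
    also have "\<dots> = (\<Sum>c\<in>E. (v c p)\<^sup>2)"
      using assms(1) by (simp add: power2_eq_square of_bool_def if_distrib cong: if_cong)
    finally have sq: "(\<Sum>q\<in>I. (?w q)\<^sup>2) = (\<Sum>c\<in>E. (v c p)\<^sup>2)" .
    have one: "(\<Sum>q\<in>I. (of_bool (p = q))\<^sup>2) = (1 :: real)"
      using p assms(2) by (simp add: of_bool_def if_distrib[of "\<lambda>z. z\<^sup>2"] cong: if_cong)
    have "0 \<le> (\<Sum>q\<in>I. (of_bool (p = q) - ?w q)\<^sup>2)"
      by (simp add: sum_nonneg)
    also have "\<dots> = (\<Sum>q\<in>I. (of_bool (p = q))\<^sup>2) + (\<Sum>q\<in>I. (?w q)\<^sup>2)
        - 2 * (\<Sum>q\<in>I. of_bool (p = q) * ?w q)"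
      by (simp only: power2_diff sum.distrib sum_subtractf sum_distrib_left mult.assoc)
    finally show ?thesis
      unfolding one sq cross by simp
  qed
  have "real (card E) = (\<Sum>c\<in>E. \<Sum>p\<in>I. (v c p)\<^sup>2)"
    using on by (simp add: power2_eq_square)
  also have "\<dots> = (\<Sum>p\<in>I. \<Sum>c\<in>E. (v c p)\<^sup>2)"
    by (rule sum.swap)
  also have "\<dots> \<le> (\<Sum>p\<in>I. 1)"
    by (rule sum_mono) (rule bessel)
  finally show ?thesis by simp
qed

definition unit_vec :: "nat \<Rightarrow> nat \<Rightarrow> real" where
  "unit_vec i = (\<lambda>h. of_bool (h = i))"

text \<open>
  The sum of squares on \<open>x = e\<^sub>i \<plusminus> e\<^sub>k\<close>, \<open>y = e\<^sub>j \<plusminus> e\<^sub>l\<close>, signed so that only the products below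
  survive; unlike the coefficient of \<open>x\<^sub>i x\<^sub>k y\<^sub>j y\<^sub>l\<close>, it needs no case distinction on \<open>i = k\<close>
  or \<open>j = l\<close>.
\<close>

definition polarize :: "form \<Rightarrow> nat \<Rightarrow> nat \<Rightarrow> nat \<Rightarrow> nat \<Rightarrow> real" where
  "polarize P i j k l =
     P (\<lambda>h. unit_vec i h + unit_vec k h) (\<lambda>h. unit_vec j h + unit_vec l h)
   - P (\<lambda>h. unit_vec i h + unit_vec k h) (\<lambda>h. unit_vec j h - unit_vec l h)
   - P (\<lambda>h. unit_vec i h - unit_vec k h) (\<lambda>h. unit_vec j h + unit_vec l h)
   + P (\<lambda>h. unit_vec i h - unit_vec k h) (\<lambda>h. unit_vec j h - unit_vec l h)"

text \<open>For a bilinear \<open>f\<close>, the value at the signed vectors is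
  \<open>A + t * B + s * C + s * t * D\<close> with signs \<open>s\<close>, \<open>t\<close>.
  Weighting its square by \<open>s * t\<close> and summing over the four sign choices leaves
  \<open>8 * (A * D + B * C)\<close>.\<close>

lemma polarize_square_sum:
  assumes "(i, j) \<in> cells m n" "(k, l) \<in> cells m n"
  shows "polarize (square_sum m n I b) i j k l =
    8 * (\<Sum>p\<in>I. b p (i, j) * b p (k, l) + b p (i, l) * b p (k, j))"
proof -
  have pick: "(\<Sum>c\<in>cells m n. a c * (unit_vec s (fst c) * unit_vec t (snd c))) = a (s, t)"
    if "(s, t) \<in> cells m n" for s t and a :: "cell \<Rightarrow> real"
  proof -
    have "(\<Sum>c\<in>cells m n. a c * (unit_vec s (fst c) * unit_vec t (snd c))) =
        (\<Sum>c\<in>cells m n. if c = (s, t) then a c else 0)"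
      by (rule sum.cong) (auto simp: unit_vec_def)
    with that show ?thesis by simp
  qed
  have mem: "(i, l) \<in> cells m n" "(k, j) \<in> cells m n"
    using assms by (auto simp: cells_def)
  show ?thesis
    by (simp add: polarize_def square_sum_def ring_distribs sum.distrib sum_subtractf
        pick assms mem)
      (simp add: sum_distrib_left power2_eq_square algebra_simps flip: sum.distrib sum_subtractf)
qed

text \<open>Both pairings of the two rows with the two columns yield the same monomial, so only the
  sum of their inner products is determined by the form.\<close>

lemma square_sum_eq_imp_gram_eq:
  assumes "square_sum m n I b = square_sum m n J b'"
    and "(i, j) \<in> cells m n" "(k, l) \<in> cells m n"
  shows "(\<Sum>p\<in>I. b p (i, j) * b p (k, l) + b p (i, l) * b p (k, j)) =
    (\<Sum>p\<in>J. b' p (i, j) * b' p (k, l) + b' p (i, l) * b' p (k, j))"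
  using polarize_square_sum[OF assms(2,3), of I b] polarize_square_sum[OF assms(2,3), of J b']
    assms(1) by simp

section \<open>The Zarankiewicz number\<close>

text \<open>
  After the first cell of each row is removed, a remaining cell is determined by the pair of
  columns formed by the first column of its row and its own column.
\<close>

lemma card_C4_free_le:
  assumes E: "E \<subseteq> cells m n" and C4: "C4_free E"
  shows "card E \<le> m + (n choose 2)"
proof -
  define \<mu> where "\<mu> i = (LEAST j. (i, j) \<in> E)" for i
  have \<mu>: "(i, \<mu> i) \<in> E \<and> \<mu> i \<le> j" if "(i, j) \<in> E" for i j
    unfolding \<mu>_def using that by (metis LeastI Least_le)
  define A where "A = E \<inter> (\<lambda>i. (i, \<mu> i)) ` {1..m}"
  have "card A \<le> card ((\<lambda>i. (i, \<mu> i)) ` {1..m})"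
    unfolding A_def by (intro card_mono) auto
  also have "\<dots> \<le> m"
    using card_image_le[of "{1..m}" "\<lambda>i. (i, \<mu> i)"] by simp
  finally have 1: "card A \<le> m" .
  let ?h = "\<lambda>(i, j). {\<mu> i, j}"
  have less: "(i, \<mu> i) \<in> E \<and> \<mu> i < j" if "(i, j) \<in> E - A" for i j
  proof -
    have "i \<in> {1..m}" using that E by (auto simp: cells_def)
    with that have "j \<noteq> \<mu> i" by (auto simp: A_def)
    with \<mu>[of i j] that show ?thesis by auto
  qed
  have "inj_on ?h (E - A)"
  proof (rule inj_onI, clarify)
    fix i j k l
    assume "(i, j) \<in> E" "(i, j) \<notin> A" "(k, l) \<in> E" "(k, l) \<notin> A" and eq: "{\<mu> i, j} = {\<mu> k, l}"
    with less[of i j] less[of k l] have *: "(i, \<mu> i) \<in> E" "\<mu> i < j" "(k, \<mu> k) \<in> E" "\<mu> k < l"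
      by auto
    with eq have eq': "\<mu> i = \<mu> k" "j = l"
      by (auto simp: doubleton_eq_iff)
    have "i = k"
    proof (rule ccontr)
      assume "i \<noteq> k"
      moreover have "{(i, \<mu> i), (i, j), (k, \<mu> i), (k, j)} \<subseteq> E"
        using * eq' \<open>(i, j) \<in> E\<close> \<open>(k, l) \<in> E\<close> by simp
      ultimately show False
        using C4 *(2) unfolding C4_free_def by (metis less_irrefl)
    qed
    with eq' show "i = k \<and> j = l" by simp
  qed
  moreover have "?h ` (E - A) \<subseteq> {B. B \<subseteq> {1..n} \<and> card B = 2}"
  proof (clarify, intro conjI)
    fix i j assume "(i, j) \<in> E" "(i, j) \<notin> A"
    with less[of i j] have "(i, \<mu> i) \<in> E" "\<mu> i < j" by auto
    with \<open>(i, j) \<in> E\<close> E show "{\<mu> i, j} \<subseteq> {1..n}" "card {\<mu> i, j} = 2"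
      by (auto simp: cells_def)
  qed
  ultimately have "card (E - A) \<le> card {B. B \<subseteq> {1..n} \<and> card B = 2}"
    by (intro card_inj_on_le) auto
  also have "\<dots> = n choose 2"
    by (simp add: n_subsets)
  finally have 2: "card (E - A) \<le> n choose 2" .
  have "finite E" "A \<subseteq> E"
    using finite_subset[OF E] by (auto simp: A_def)
  then have "card E = card A + card (E - A)"
    by (metis card_Diff_subset card_mono finite_subset le_add_diff_inverse)
  with 1 2 show ?thesis by simp
qed

lemma zarankiewicz_eqI:
  assumes "E \<subseteq> cells m n" "C4_free E" "card E = z"
    and "\<And>F. F \<subseteq> cells m n \<Longrightarrow> C4_free F \<Longrightarrow> card F \<le> z"
  shows "zarankiewicz m n = z"
  unfolding zarankiewicz_def
proof (rule Max_eqI)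
  show "finite {card E | E. E \<subseteq> cells m n \<and> C4_free E}"
    by (rule finite_subset[of _ "{..z}"]) (use assms(4) in auto)
qed (use assms in auto)

section \<open>The witness\<close>

text \<open>Rows 1 to 3 form a 6-cycle, each using a different pair of columns. Rows 4 and 5 hold
  one edge each, leaving two cells for a 2-edge.\<close>

definition ones :: "cell set" where
  "ones = {(1, 1), (1, 2), (2, 1), (2, 3), (3, 2), (3, 3), (4, 1), (5, 2)}"

text \<open>Rows 4 and 5 are now full, so exactly (1,3), (2,2) and (3,1) stay unoccupied.\<close>

definition twos :: "edge set" where
  "twos = {{(4, 2), (4, 3)}, {(5, 1), (5, 3)}}"

lemma C4_free_ones: "C4_free ones"
proof -
  have "\<forall>c\<in>ones. \<forall>d\<in>ones. fst c \<noteq> fst d \<longrightarrow> snd c \<noteq> snd d \<longrightarrow>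
      (fst c, snd d) \<notin> ones \<or> (fst d, snd c) \<notin> ones"
    by (simp add: ones_def)
  then show ?thesis
    unfolding C4_free_def by fastforce
qed

lemma card_ones: "card ones = 8"
  by (simp add: ones_def)

lemma ones_subset: "ones \<subseteq> cells 5 3"
  by (auto simp: ones_def cells_def)

lemma zarankiewicz_5_3: "zarankiewicz 5 3 = 8"
proof (rule zarankiewicz_eqI[OF ones_subset C4_free_ones card_ones])
  fix F assume "F \<subseteq> cells 5 3" "C4_free F"
  then show "card F \<le> 8"
    \<comment> \<open>Three columns form three pairs, so the bound is 5 + 3.\<close>
    using card_C4_free_le[of F 5 3] by (simp add: choose_two)
qed

lemma not_nondegenerate_twos: "e \<in> twos \<Longrightarrow> \<not> nondegenerate e"
  by (auto simp: twos_def nondegenerate_def doubleton_eq_iff)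

lemma z_wL_ge:
  assumes "augmented_graph m n E1 E2" "cond_S E1 E2" "cond_W1 E1" "cond_W2 E1 E2"
    "cond_W2' E1 E2" "cond_W3 E1 E2" "card E1 = zarankiewicz m n"
  shows "card E1 + card E2 \<le> z_wL m n"
proof -
  have "two_edges m n \<subseteq> Pow (cells m n)"
    by (auto simp: two_edges_def)
  then have fin: "finite (two_edges m n)"
    by (rule finite_subset) simp
  have bound: "card F1 + card F2 \<le> m * n + card (two_edges m n)" if "augmented_graph m n F1 F2" for F1 F2
    using that fin card_mono[of "cells m n" F1] card_mono[of "two_edges m n" F2]
    by (simp add: augmented_graph_def add_mono)
  have "finite {card E1 + card E2 | E1 E2. augmented_graph m n E1 E2}"
    by (rule finite_subset[of _ "{..m * n + card (two_edges m n)}"]) (use bound in auto)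
  then have fin: "finite {card E1 + card E2 | E1 E2.
     augmented_graph m n E1 E2 \<and> cond_S E1 E2 \<and> cond_W1 E1 \<and> cond_W2 E1 E2 \<and>
     cond_W2' E1 E2 \<and> cond_W3 E1 E2 \<and> card E1 = zarankiewicz m n}"
    by (rule rev_finite_subset) blast
  show ?thesis
    unfolding z_wL_def
    by (rule Max_ge[OF fin], rule CollectI, intro exI[of _ E1] exI[of _ E2] conjI refl assms)
qed

lemma z_wL_5_3: "z_wL 5 3 \<ge> 10"
proof -
  have "{(4, 2), (4, 3)} \<in> two_edges 5 3" "{(5, 1), (5, 3)} \<in> two_edges 5 3"
    unfolding two_edges_def cells_def by force+
  then have "augmented_graph 5 3 ones twos"
    using ones_subset by (simp add: augmented_graph_def twos_def)
  moreover have "cond_S ones twos"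
    by (auto simp: cond_S_def ones_def twos_def)
  moreover have "cond_W1 ones"
    using C4_free_ones by (simp add: cond_W1_def)
  moreover have "cond_W2 ones twos"
    using not_nondegenerate_twos
    by (auto simp: cond_W2_def dependency_graph_def pre_digraph.cycle_def pre_digraph.awalk_def)
  moreover have "cond_W2' ones twos"
    using not_nondegenerate_twos by (auto simp: cond_W2'_def)
  \<comment> \<open>The 2-edges share column 3. A 1-edge vertex-disjoint from one of them lies in
    rows 1 to 3 and in the single column the 2-edge misses, so the empty cell of its row is an
    opposite cell.\<close>
  moreover have "cond_W3 ones twos"
    by (simp add: cond_W3_def vertex_disjoint_def pair_opposite_cells_def occupied_def ones_def twos_def)
  moreover have "card ones = zarankiewicz 5 3"
    by (simp add: card_ones zarankiewicz_5_3)
  ultimately have "card ones + card twos \<le> z_wL 5 3"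
    by (rule z_wL_ge)
  moreover have "card twos = 2"
    by (simp add: twos_def doubleton_eq_iff)
  ultimately show ?thesis
    by (simp add: card_ones)
qed

text \<open>
  The form of the graph \<open>(ones, twos)\<close>: its squares are indexed by the edges, and \<open>rep\<close> sends both
  halves of a 2-edge to the half that represents this edge.
\<close>

definition rep :: "cell \<Rightarrow> cell" where
  "rep c = (if c = (4, 3) then (4, 2) else if c = (5, 3) then (5, 1) else c)"

definition reps :: "cell set" where
  "reps = insert (4, 2) (insert (5, 1) ones)"

definition witness_form :: form where
  "witness_form = square_sum 5 3 reps (\<lambda>q c. of_bool (rep c = q))"

lemma card_reps: "finite reps" "card reps = 10"
  by (simp_all add: reps_def ones_def)

text \<open>Across two rows, only sums of two inner products are known. Each inner product is
  isolated by a relation whose other summand already vanishes, starting from the unoccupied cells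
  and the equal halves of the 2-edges.\<close>

lemma witness_gram_orthonormal:
  fixes b :: "'i \<Rightarrow> cell \<Rightarrow> real"
  assumes fin: "finite I" and eq: "witness_form = square_sum 5 3 I b"
    and cd: "c \<in> reps" "d \<in> reps"
  shows "(\<Sum>p\<in>I. b p c * b p d) = of_bool (c = d)"
proof -
  define g where "g c d = (\<Sum>p\<in>I. b p c * b p d)" for c d
  have comm: "g c d = g d c" for c d
    by (simp add: g_def mult.commute)
  have rel: "g (i, j) (k, l) + g (i, l) (k, j) =
      of_bool (rep (i, j) = rep (k, l) \<and> rep (i, j) \<in> reps)
      + of_bool (rep (i, l) = rep (k, j) \<and> rep (i, l) \<in> reps)"
    if "(i, j) \<in> cells 5 3" "(k, l) \<in> cells 5 3" for i j k l
  proof -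
    have pair: "(\<Sum>q\<in>reps. of_bool (rep c = q) * of_bool (rep d = q)) =
        (of_bool (rep c = rep d \<and> rep c \<in> reps) :: real)" for c d
    proof -
      have "(\<Sum>q\<in>reps. of_bool (rep c = q) * of_bool (rep d = q)) =
          (\<Sum>q\<in>reps. if rep c = q then of_bool (rep c = rep d) else 0 :: real)"
        by (rule sum.cong) auto
      then show ?thesis using card_reps by simp
    qed
    show ?thesis
      using square_sum_eq_imp_gram_eq[OF eq[unfolded witness_form_def, symmetric] that]
      by (simp add: g_def sum.distrib pair)
  qed
  have zero: "g c d = 0" if "g c c = 0" for c d
  proof -
    have "\<forall>p\<in>I. b p c = 0"
      using that fin by (simp add: g_def sum_nonneg_eq_0_iff)
    then show ?thesis by (simp add: g_def)
  qed
  \<comment> \<open>Two unit vectors with inner product 1 are at distance 0.\<close>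
  have merge: "g c e = g d e" if "g c c = 1" "g d d = 1" "g c d = 1" for c d e
  proof -
    have "(\<Sum>p\<in>I. (b p c - b p d)\<^sup>2) = g c c + g d d - 2 * g c d"
      by (simp add: g_def power2_eq_square algebra_simps sum.distrib sum_subtractf sum_distrib_left)
    with that have "\<forall>p\<in>I. b p c = b p d"
      using fin by (simp add: sum_nonneg_eq_0_iff)
    then show ?thesis by (simp add: g_def)
  qed
  \<comment> \<open>Keeps the literal 1 in cells from becoming \<open>Suc 0\<close>, so that the
    facts about concrete cells still match.\<close>
  note [simp del] = One_nat_def
  note defs = rep_def reps_def ones_def
  have cells: "(i, j) \<in> cells 5 3 \<longleftrightarrow> i \<in> {1..5} \<and> j \<in> {1..3}" for i j
    by (simp add: cells_def)
  have diag: "g c c = of_bool (rep c \<in> reps)" if "c \<in> cells 5 3" for c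
    using rel[of "fst c" "snd c" "fst c" "snd c"] that by simp
  have same_row: "g (i, j) (i, l) = of_bool (rep (i, j) = rep (i, l) \<and> rep (i, j) \<in> reps)"
    if "(i, j) \<in> cells 5 3" "(i, l) \<in> cells 5 3" for i j l
    using rel[OF that] comm[of "(i, l)" "(i, j)"] by (simp add: eq_commute[of "rep (i, l)"] cong: conj_cong)
  have cross: "g (i, j) (k, l) + g (i, l) (k, j) = 0"
    if "i \<noteq> k" "(i, j) \<in> cells 5 3" "(k, l) \<in> cells 5 3" for i j k l
  proof -
    have "fst (rep c) = fst c" for c
      by (auto simp: rep_def)
    with \<open>i \<noteq> k\<close> have "rep (i, s) \<noteq> rep (k, t)" for s t
      by (metis fst_conv)
    then show ?thesis
      using rel[OF that(2,3)] by simp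
  qed
  have same_col: "g (i, j) (k, j) = 0"
    if "i \<noteq> k" "(i, j) \<in> cells 5 3" "(k, j) \<in> cells 5 3" for i j k
    using cross[OF that] by simp
  have empty: "g (1, 3) e = 0" "g (2, 2) e = 0" "g (3, 1) e = 0" for e
    by (rule zero, simp add: diag cells, simp add: defs)+
  have empty': "g e (1, 3) = 0" "g e (2, 2) = 0" "g e (3, 1) = 0" for e
    using empty[of e] by (simp_all only: comm[of e])
  have merged: "g (4, 3) e = g (4, 2) e" "g (5, 3) e = g (5, 1) e" for e
    by (rule merge; simp add: diag same_row cells; simp add: defs)+
  have merged': "g e (4, 3) = g e (4, 2)" "g e (5, 3) = g e (5, 1)" for e
    using merged[of e] by (simp_all only: comm[of e])
  have cross_empty: "g (i, j) (k, l) = 0"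
    if "i \<noteq> k" "(i, j) \<in> cells 5 3" "(k, l) \<in> cells 5 3"
      "{(i, l), (k, j)} \<inter> {(1, 3), (2, 2), (3, 1)} \<noteq> {}" for i j k l
    using cross[OF that(1-3)] that(4) empty empty' by auto
  note rules = cells empty empty' merged merged' same_col cross_empty
  \<comment> \<open>Column 3 is used because merging turns its cells in rows 4 and 5 into the
    representatives, while (1,3) is empty.\<close>
  have A: "g (4, 2) (5, 1) = 0" "g (1, 1) (4, 2) = 0" "g (1, 2) (5, 1) = 0"
    using cross[of 4 5 3 3] cross[of 1 4 1 3] cross[of 1 5 2 3] by (simp_all add: rules)
  \<comment> \<open>In each relation the other summand vanishes by \<open>A\<close>,
    \<open>same_col\<close> or \<open>cross_empty\<close>, after merging where needed.\<close>
  then have B: "g (4, 1) (5, 2) = 0" "g (1, 2) (4, 1) = 0" "g (1, 1) (5, 2) = 0"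
    "g (2, 3) (4, 1) = 0" "g (2, 3) (5, 1) = 0" "g (3, 3) (4, 2) = 0" "g (3, 3) (5, 2) = 0"
    using cross[of 4 5 1 2] cross[of 1 4 2 1] cross[of 1 5 1 2] cross[of 2 4 3 1]
      cross[of 2 5 3 1] cross[of 3 4 3 2] cross[of 3 5 3 2]
    by (simp_all add: rules)
  have less: "\<forall>c\<in>reps. \<forall>d\<in>reps. fst c < fst d \<longrightarrow> g c d = 0"
    by (simp add: reps_def ones_def rules A B)
  have reps: "c \<in> cells 5 3 \<and> rep c = c" if "c \<in> reps" for c
    using that by (auto simp: defs cells)
  have row: "g c d = of_bool (c = d)" if "c \<in> reps" "d \<in> reps" "fst c = fst d" for c d
    using that same_row[of "fst c" "snd c" "snd d"] reps[of c] reps[of d]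
    by (cases c; cases d) auto
  have "g c d = of_bool (c = d)"
    using less row cd comm[of c d] by (cases "fst c" "fst d" rule: linorder_cases) auto
  then show ?thesis
    by (simp add: g_def)
qed

lemma BSR_5_3: "BSR 5 3 \<ge> 10"
proof -
  have ex: "sum_of_squares 5 3 10 witness_form"
    using sum_of_squares_square_sum[of reps 5 3] by (simp add: witness_form_def card_reps)
  have "10 \<le> r" if "sum_of_squares 5 3 r witness_form" for r
  proof -
    from that obtain b where "witness_form = square_sum 5 3 {1..r} b"
      unfolding sum_of_squares_iff by blast
    then have "card reps \<le> card {1..r}"
      using card_reps witness_gram_orthonormal[of "{1..r}" b]
      by (intro card_orthonormal_le[of _ _ "\<lambda>c p. b p c"]) auto
    then show ?thesis by (simp add: card_reps)
  qed
  with ex have "10 \<le> SOS_rank 5 3 witness_form"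
    unfolding SOS_rank_def by (metis LeastI)
  also have "\<dots> \<le> BSR 5 3"
    using ex biquadratic_form_square_sum
    by (intro SOS_rank_le_BSR) (auto simp: SOS_def witness_form_def)
  finally show ?thesis .
qed

theorem theorem11:
  shows "z_wL 5 3 \<ge> 10 \<and> BSR 5 3 \<ge> 10"
  using z_wL_5_3 BSR_5_3 by simp

end
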